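(* Let $m$ and $n$ be positive integers. Define $2^k\times 2^k$ matrices $X_k^+, X_k^-, O_k^+, O_k^-$ recursively by the $1\times 1$ matrices $X_0^+ = O_0^+ = \begin{bmatrix} 1 \end{bmatrix}$, $X_0^- = O_0^- = \begin{bmatrix} 0 \end{bmatrix}$ and, for $k=0,1,\dots,m-1$, $$ X_{k+1}^+ = \begin{bmatrix} X_k^+ & O_k^- \\ O_k^- & X_k^+ + O_k^- \end{bmatrix}, \qquad X_{k+1}^- = \begin{bmatrix} X_k^- & O_k^+ \\ O_k^+ & X_k^- + O_k^+ \end{bmatrix}, $$ $$ O_{k+1}^+ = \begin{bmatrix} O_k^+ & X_k^- + O_k^+ \\ X_k^- + O_k^+ & X_k^- + 5\, O_k^+ \end{bmatrix}, \qquad O_{k+1}^- = \begin{bmatrix} O_k^- & X_k^+ + O_k^- \\ X_k^+ + O_k^- & X_k^+ + 5\, O_k^- \end{bmatrix}. $$ Define $2^{m+k}\times 2^{m+k}$ matrices $\widehat{N}^{(m,k)}_G$ recursively by $\widehat{N}^{(m,0)}_G = I_m$ and, for $k=0,1,\dots,n-1$, $$\widehat{N}^{(m,k+1)}_G = \begin{bmatrix} \widehat{N}^{(m,k)}_G \cdot (I_k \otimes X_m^+) & \widehat{N}^{(m,k)}_G \cdot (I_k \otimes O_m^-) \\ \widehat{N}^{(m,k)}_G \cdot (I_k \otimes X_m^-) & \widehat{N}^{(m,k)}_G \cdot (I_k \otimes O_m^+) \end{bmatrix}. $$ Let $x_{ij}$ denote the $(i,j)$-entry of the $2^{m+n}\times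 2^{m+n}$ matrix $\widehat{N}^{(m,n)}_G$. Then the total number $D^{(m+2,n+2)}_G$ of graph $(m+2,n+2)$-mosaics is $$D^{(m+2,n+2)}_G = \sum_{i,\,j=1}^{2^{m+n}} L_{b(i,j)}\, x_{ij}.$$
   Context: Graph mosaic tiles. There are sixteen graph mosaic tiles $T_0,\dots,T_{15}$, each a unit square carrying a piece of a graph diagram. A connection point of a tile is the midpoint of one of its four edges (left, right, top, bottom) that is an endpoint of the piece of graph drawn on it. For counting purposes the tiles are described by their sets of connection points, as subsets of $\{\text{left},\text{right},\text{top},\text{bottom}\}$: there is exactly one tile with no connection point ($T_0$); for each of the six two-element subsets exactly one tile with that set of connection points ($T_1,\dots,T_6$); for each of the four three-element subsets exactly one tile with that set ($T_{11},\dots,T_{14}$, trivalent vertices); exactly five distinct tiles with all four connection points ($T_7,T_8,T_9,T_{10},T_{15}$); and no tile with exactly one connection point. Tiles are not rotated or reflected. Mosaics. For positive integers $p,q$, a $(p,q)$-mosaic is a $p\times q$ matrix ($p$ rows, $q$ columns, laid out as a rectangle of squares) of graph mosaic tiles. It is suitably connected if for any two tiles adjacent in the same row or the same column, either both or neither have a connection point on their common edge. A graph $(p,q)$-mosaic is a suitably connected $(p,q)$-mosaic with no connection points on the boundary of the $p\times q$ rectangle. $D^{(p,q)}_G$ is the number of graph $(p,q)$-mosaics (distinct matrices of tiles are counted as distinct). Notation. $I_k$ is the identity matrix of size $2^k\times 2^k$. $\otimes$ is the Kronecker product, so $I_k\otimes A$ is block diagonal with $2^k$ diagonal blocks equal to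 $A$. $L_k=\frac{(1+\sqrt5)^k+(1-\sqrt5)^k}{2^k}$ is the $k$-th Lucas number ($L_0=2$, $L_1=1$). $b(i,j)$ is the sum of the Hamming weights (number of 1's) of the binary expansions of $i-1$ and $j-1$. *)

theory Defs
  imports Complex_Main "Jordan_Normal_Form.Matrix"
begin

datatype side = LeftSide | RightSide | TopSide | BottomSide

datatype tile =
  T0 | T1 | T2 | T3 | T4 | T5 | T6 | T7 | T8 | T9 | T10 | T11 | T12 | T13 | T14 | T15

(* Which two-element set belongs to which of T1, ..., T6, and which three-element set
   to which of T11, ..., T14, is immaterial: only the number of tiles with a given set
   of connection points is used. *)
fun connection_points :: "tile \<Rightarrow> side set" where
  "connection_points T0 = {}"
| "connection_points T1 = {LeftSide, BottomSide}"
| "connection_points T2 = {RightSide, BottomSide}"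
| "connection_points T3 = {RightSide, TopSide}"
| "connection_points T4 = {LeftSide, TopSide}"
| "connection_points T5 = {LeftSide, RightSide}"
| "connection_points T6 = {TopSide, BottomSide}"
| "connection_points T7 = {LeftSide, RightSide, TopSide, BottomSide}"
| "connection_points T8 = {LeftSide, RightSide, TopSide, BottomSide}"
| "connection_points T9 = {LeftSide, RightSide, TopSide, BottomSide}"
| "connection_points T10 = {LeftSide, RightSide, TopSide, BottomSide}"
| "connection_points T11 = {LeftSide, RightSide, BottomSide}"
| "connection_points T12 = {RightSide, TopSide, BottomSide}"
| "connection_points T13 = {LeftSide, RightSide, TopSide}"
| "connection_points T14 = {LeftSide, TopSide, BottomSide}"
| "connection_points T15 = {LeftSide, RightSide, TopSide, BottomSide}"

(* Rows are numbered from top to bottom and columns from left to right, starting at 0. *)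
definition suitably_connected :: "tile mat \<Rightarrow> bool" where
  "suitably_connected M \<longleftrightarrow>
     (\<forall>i j. i < dim_row M \<and> Suc j < dim_col M \<longrightarrow>
        (RightSide \<in> connection_points (M $$ (i, j)) \<longleftrightarrow>
         LeftSide \<in> connection_points (M $$ (i, Suc j)))) \<and>
     (\<forall>i j. Suc i < dim_row M \<and> j < dim_col M \<longrightarrow>
        (BottomSide \<in> connection_points (M $$ (i, j)) \<longleftrightarrow>
         TopSide \<in> connection_points (M $$ (Suc i, j))))"

definition no_boundary_points :: "tile mat \<Rightarrow> bool" where
  "no_boundary_points M \<longleftrightarrow>
     (\<forall>i < dim_row M.
        LeftSide \<notin> connection_points (M $$ (i, 0)) \<and>
        RightSide \<notin> connection_points (M $$ (i, dim_col M - 1))) \<and>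
     (\<forall>j < dim_col M.
        TopSide \<notin> connection_points (M $$ (0, j)) \<and>
        BottomSide \<notin> connection_points (M $$ (dim_row M - 1, j)))"

definition graph_mosaics :: "nat \<Rightarrow> nat \<Rightarrow> tile mat set" where
  "graph_mosaics p q = {M \<in> carrier_mat p q. suitably_connected M \<and> no_boundary_points M}"

definition D_G :: "nat \<Rightarrow> nat \<Rightarrow> nat" where
  "D_G p q = card (graph_mosaics p q)"

fun Xp :: "nat \<Rightarrow> int mat" and Xm :: "nat \<Rightarrow> int mat"
  and Op :: "nat \<Rightarrow> int mat" and Om :: "nat \<Rightarrow> int mat" where
  "Xp 0 = mat 1 1 (\<lambda>_. 1)"
| "Xm 0 = mat 1 1 (\<lambda>_. 0)"
| "Op 0 = mat 1 1 (\<lambda>_. 1)"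
| "Om 0 = mat 1 1 (\<lambda>_. 0)"
| "Xp (Suc k) = four_block_mat (Xp k) (Om k) (Om k) (Xp k + Om k)"
| "Xm (Suc k) = four_block_mat (Xm k) (Op k) (Op k) (Xm k + Op k)"
| "Op (Suc k) = four_block_mat (Op k) (Xm k + Op k) (Xm k + Op k) (Xm k + 5 \<cdot>\<^sub>m Op k)"
| "Om (Suc k) = four_block_mat (Om k) (Xp k + Om k) (Xp k + Om k) (Xp k + 5 \<cdot>\<^sub>m Om k)"

definition kronecker :: "'a :: semiring_1 mat \<Rightarrow> 'a mat \<Rightarrow> 'a mat" (infixl "\<otimes>\<^sub>K" 75) where
  "A \<otimes>\<^sub>K B = mat (dim_row A * dim_row B) (dim_col A * dim_col B)
     (\<lambda>(i, j). A $$ (i div dim_row B, j div dim_col B) *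
                B $$ (i mod dim_row B, j mod dim_col B))"

abbreviation Idm :: "nat \<Rightarrow> int mat" where
  "Idm k \<equiv> 1\<^sub>m (2 ^ k)"

fun N_hat :: "nat \<Rightarrow> nat \<Rightarrow> int mat" where
  "N_hat m 0 = Idm m"
| "N_hat m (Suc k) = four_block_mat
     (N_hat m k * (Idm k \<otimes>\<^sub>K Xp m)) (N_hat m k * (Idm k \<otimes>\<^sub>K Om m))
     (N_hat m k * (Idm k \<otimes>\<^sub>K Xm m)) (N_hat m k * (Idm k \<otimes>\<^sub>K Op m))"

definition lucas :: "nat \<Rightarrow> real" where
  "lucas k = ((1 + sqrt 5) ^ k + (1 - sqrt 5) ^ k) / 2 ^ k"

definition hamming_weight :: "nat \<Rightarrow> nat" where
  "hamming_weight x = card {i. bit x i}"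

definition b_weight :: "nat \<Rightarrow> nat \<Rightarrow> nat" where
  "b_weight i j = hamming_weight (i - 1) + hamming_weight (j - 1)"

end

(* Describe a mosaic by the states (connection point or not) of its edges; a tile position then
   carries a weight depending on its four edges, and mosaics are counted by walks: along a column
   the state is the horizontal edge just crossed, along the grid it is the vertical edge vector just
   crossed, encoded by the bits of a number below 2^m.
   Adding the tile of row k to a column adds a most significant bit to both edge vectors, which is the recursion for
   X and O (no connection point / connection point at the bottom end of the column; the sign records
   whether the edge at the top end agrees with the letter). Adding a column to the grid gives the recursion for
   N_hat, whose (L + 2^m T, R + 2^m B) entry counts the m x n fillings with left, right, top and
   bottom boundary states L, R, T, B.
   In an (m+2) x (n+2) mosaic, the outer ring of tiles is a closed walk on the ring edges. A ring tile facing an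
   interior edge without connection point acts as the identity on the two ring edges, one facing a
   connection point acts as the Fibonacci matrix [[0,1],[1,1]], and the corners act as the identity. So the
   ring can be completed in tr [[0,1],[1,1]]^b = L_b ways, b being the number of
   connection points on the boundary of the interior. *)
theory Submission
  imports Defs
begin

section \<open>Weighted walks\<close>

text \<open>The \<open>(x, y)\<close> entry of the product of the matrices \<open>A 0\<close>, ...,
  \<open>A (n - 1)\<close> indexed by \<open>S\<close>, that is, the transfer matrix count of
  weighted walks.\<close>

primrec walk :: "'s set \<Rightarrow> (nat \<Rightarrow> 's \<Rightarrow> 's \<Rightarrow> int) \<Rightarrow> nat \<Rightarrow> 's \<Rightarrow> 's \<Rightarrow> int" where
  "walk S A 0 x y = of_bool (x = y)"
| "walk S A (Suc n) x y = (\<Sum>z\<in>S. walk S A n x z * A n z y)"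

lemma walk_cong:
  assumes "\<And>r x y. r < n \<Longrightarrow> A r x y = B r x y"
  shows "walk S A n x y = walk S B n x y"
  using assms by (induction n arbitrary: y) (auto intro!: sum.cong)

text \<open>Associativity of the matrix product: the recursion splits off the last factor, while the
  topmost tile of a column has to be split off first.\<close>

lemma walk_Suc_left:
  assumes "finite S" "x \<in> S" "y \<in> S"
  shows "walk S A (Suc n) x y = (\<Sum>z\<in>S. A 0 x z * walk S (\<lambda>r. A (Suc r)) n z y)"
  using assms(3)
proof (induction n arbitrary: y)
  case 0
  have "(\<Sum>z\<in>S. of_bool (x = z) * A 0 z y) = A 0 x y"
    using assms by (simp add: of_bool_def if_distrib[of "\<lambda>u. u * _"] cong: if_cong)
  moreover have "(\<Sum>z\<in>S. A 0 x z * of_bool (z = y)) = A 0 x y"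
    using assms 0 by (simp add: of_bool_def if_distrib[of "\<lambda>u. _ * u"] cong: if_cong)
  ultimately show ?case by simp
next
  case (Suc n)
  have "walk S A (Suc (Suc n)) x y = (\<Sum>z\<in>S. walk S A (Suc n) x z * A (Suc n) z y)"
    by simp
  also have "\<dots> = (\<Sum>z\<in>S. (\<Sum>c\<in>S. A 0 x c * walk S (\<lambda>r. A (Suc r)) n c z) * A (Suc n) z y)"
    using Suc.IH by (intro sum.cong) (auto simp del: walk.simps)
  also have "\<dots> = (\<Sum>c\<in>S. \<Sum>z\<in>S. A 0 x c * walk S (\<lambda>r. A (Suc r)) n c z * A (Suc n) z y)"
    by (subst sum.swap) (simp add: sum_distrib_right)
  finally show ?case
    by (simp add: sum_distrib_left mult.assoc)
qed

text \<open>The labels \<open>t\<close> are what is counted; the states \<open>v\<close> need only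
  exist. \<open>extensional\<close> fixes the values from \<open>n\<close> on, so that each label
  sequence is one function.\<close>

definition walks :: "'s set \<Rightarrow> (nat \<Rightarrow> 's \<Rightarrow> 's \<Rightarrow> 'a set) \<Rightarrow> nat \<Rightarrow> 's \<Rightarrow> 's \<Rightarrow> (nat \<Rightarrow> 'a) set" where
  "walks S A n x y = {t \<in> extensional {..<n}. \<exists>v. v 0 = x \<and> v n = y \<and>
     (\<forall>r<n. v r \<in> S \<and> t r \<in> A r (v r) (v (Suc r)))}"

lemma walks_0:
  fixes x :: 's
  shows "walks S A 0 x y = (if x = y then {\<lambda>_. undefined} else {})"
proof -
  have "\<exists>v :: nat \<Rightarrow> 's. v 0 = y" by auto
  then show ?thesis by (auto simp: walks_def)
qed

lemma walks_Suc:
  "walks S A (Suc n) x y = (\<Union>z\<in>S. (\<lambda>(t, a). t(n := a)) ` (walks S A n x z \<times> A n z y))"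
proof (intro equalityI subsetI)
  fix t assume "t \<in> walks S A (Suc n) x y"
  then obtain v where t: "t \<in> extensional {..<Suc n}" and v: "v 0 = x" "v (Suc n) = y"
    "\<And>r. r < Suc n \<Longrightarrow> v r \<in> S \<and> t r \<in> A r (v r) (v (Suc r))"
    unfolding walks_def by auto
  let ?t = "restrict t {..<n}"
  have "?t \<in> walks S A n x (v n)"
    unfolding walks_def using v by (auto intro!: exI[of _ v])
  moreover have "t = ?t(n := t n)"
    using t by (auto simp: extensional_def restrict_def fun_eq_iff less_Suc_eq)
  moreover have "t n \<in> A n (v n) y" "v n \<in> S" using v(3)[of n] v(2) by auto
  ultimately show "t \<in> (\<Union>z\<in>S. (\<lambda>(t, a). t(n := a)) ` (walks S A n x z \<times> A n z y))"
    by (intro UN_I[of "v n"] image_eqI[of _ _ "(?t, t n)"]) auto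
next
  fix u assume "u \<in> (\<Union>z\<in>S. (\<lambda>(t, a). t(n := a)) ` (walks S A n x z \<times> A n z y))"
  then obtain z t a where z: "z \<in> S" "t \<in> walks S A n x z" "a \<in> A n z y" "u = t(n := a)"
    by auto
  then obtain v where t: "t \<in> extensional {..<n}" and v: "v 0 = x" "v n = z"
    "\<And>r. r < n \<Longrightarrow> v r \<in> S \<and> t r \<in> A r (v r) (v (Suc r))"
    unfolding walks_def by auto
  show "u \<in> walks S A (Suc n) x y"
    unfolding walks_def using z t v
    by (auto simp: extensional_def less_Suc_eq intro!: exI[of _ "v(Suc n := y)"])
qed

text \<open>By \<open>det\<close> a label and the state after it fix the state before it. Hence the
  union over \<open>z\<close> in \<open>walks_Suc\<close> is disjoint, and cardinalities obey the
  recursion of \<open>walk\<close>.\<close>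

lemma card_walks:
  assumes "finite S" and fin: "\<And>r x y. finite (A r x y)"
    and det: "\<And>r a z z' y. \<lbrakk>a \<in> A r z y; a \<in> A r z' y; z \<in> S; z' \<in> S\<rbrakk> \<Longrightarrow> z = z'"
  shows "finite (walks S A n x y) \<and>
    int (card (walks S A n x y)) = walk S (\<lambda>r x y. int (card (A r x y))) n x y"
proof (induction n arbitrary: y)
  case 0
  show ?case by (simp add: walks_0)
next
  case (Suc n)
  let ?f = "\<lambda>(t, a). t(n := a)"
  have inj: "inj_on ?f (walks S A n x z \<times> A n z y)" for z
  proof (intro inj_onI, clarify)
    fix t a t' a'
    assume tt: "t \<in> walks S A n x z" "t' \<in> walks S A n x z" and eq: "t(n := a) = t'(n := a')"
    have "t r = t' r" for r
    proof (cases "r = n")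
      case True
      then show ?thesis using tt by (simp add: walks_def extensional_def)
    next
      case False
      then show ?thesis using fun_cong[OF eq, of r] by simp
    qed
    with fun_cong[OF eq, of n] show "t = t' \<and> a = a'" by auto
  qed
  have disj: "?f ` (walks S A n x z \<times> A n z y) \<inter> ?f ` (walks S A n x z' \<times> A n z' y) = {}"
    if "z \<in> S" "z' \<in> S" "z \<noteq> z'" for z z'
  proof -
    have False if "t(n := a) = t'(n := a')" "a \<in> A n z y" "a' \<in> A n z' y" for t t' a a'
      using fun_cong[OF that(1), of n] that(2,3) det \<open>z \<in> S\<close> \<open>z' \<in> S\<close> \<open>z \<noteq> z'\<close> by auto
    then show ?thesis by auto
  qed
  have "int (card (walks S A (Suc n) x y)) = (\<Sum>z\<in>S. int (card (?f ` (walks S A n x z \<times> A n z y))))"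
    unfolding walks_Suc using assms(1) Suc.IH fin disj by (subst card_UN_disjoint) auto
  also have "\<dots> = (\<Sum>z\<in>S. int (card (walks S A n x z)) * int (card (A n z y)))"
    by (simp add: card_image[OF inj] card_cartesian_product)
  finally show ?case using Suc.IH fin assms(1) by (simp add: walks_Suc)
qed

section \<open>Numbers below a power of two as bit vectors\<close>

lemma sum_split_low_high:
  fixes f :: "nat \<Rightarrow> 'a::comm_monoid_add"
  shows "(\<Sum>i<2 ^ (a + b). f i) = (\<Sum>x<2 ^ a. \<Sum>y<2 ^ b. f (x + 2 ^ a * y))"
proof -
  have "(\<Sum>i<2 ^ (a + b). f i) = (\<Sum>p\<in>{..<2 ^ a} \<times> {..<2 ^ b}. f (fst p + 2 ^ a * snd p))"
  proof (rule sum.reindex_bij_witness[of _ "\<lambda>p. fst p + 2 ^ a * snd p" "\<lambda>i. (i mod 2 ^ a, i div 2 ^ a)"])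
    fix p :: "nat \<times> nat" assume p: "p \<in> {..<2 ^ a} \<times> {..<2 ^ b}"
    then have "fst p + 2 ^ a * snd p < 2 ^ a * Suc (snd p)" by auto
    also have "\<dots> \<le> 2 ^ a * 2 ^ b" using p by (intro mult_left_mono) auto
    finally show "fst p + 2 ^ a * snd p \<in> {..<2 ^ (a + b)}" by (simp add: power_add)
  qed (auto simp: power_add less_mult_imp_div_less mult.commute)
  then show ?thesis by (simp add: sum.cartesian_product case_prod_beta)
qed

lemma sum_split_high_bit:
  fixes f :: "nat \<Rightarrow> 'a::comm_monoid_add"
  shows "(\<Sum>i<2 ^ Suc n. f i) = (\<Sum>x<2 ^ n. \<Sum>t\<in>UNIV. f (x + 2 ^ n * of_bool t))"
  using sum_split_low_high[of f n 1] by (simp add: UNIV_bool lessThan_nat_numeral numeral_2_eq_2 add.commute)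

lemma bit_low_high:
  fixes L :: nat
  assumes "L < 2 ^ m"
  shows "bit (L + 2 ^ m * T) r = (if r < m then bit L r else bit T (r - m))"
proof -
  have "take_bit m (L + 2 ^ m * T) = L" "drop_bit m (L + 2 ^ m * T) = T"
    using assms by (auto simp: take_bit_eq_mod drop_bit_eq_div)
  then show ?thesis
    by (metis bit_drop_bit_eq bit_take_bit_iff comp_apply le_add_diff_inverse not_less)
qed

lemma bit_high_false: "(L::nat) < 2 ^ m \<Longrightarrow> m \<le> r \<Longrightarrow> \<not> bit L r"
  by (metis bit_take_bit_iff not_less take_bit_nat_eq_self)

section \<open>Tiles\<close>

definition fits :: "bool \<Rightarrow> bool \<Rightarrow> bool \<Rightarrow> bool \<Rightarrow> tile set" where
  "fits l r t b = {x. (LeftSide \<in> connection_points x) = l \<and> (RightSide \<in> connection_points x) = r \<and>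
     (TopSide \<in> connection_points x) = t \<and> (BottomSide \<in> connection_points x) = b}"

definition weight :: "bool \<Rightarrow> bool \<Rightarrow> bool \<Rightarrow> bool \<Rightarrow> int" where
  "weight l r t b = (if l \<and> r \<and> t \<and> b then 5
     else of_bool (\<not> (of_bool l + of_bool r + of_bool t + of_bool b = (1 :: nat))))"

lemma UNIV_tile:
  "(UNIV :: tile set) = {T0, T1, T2, T3, T4, T5, T6, T7, T8, T9, T10, T11, T12, T13, T14, T15}"
  using tile.exhaust by auto

lemma finite_fits: "finite (fits l r t b)"
  by (rule finite_subset[of _ UNIV]) (simp, simp add: UNIV_tile)

lemma card_fits: "int (card (fits l r t b)) = weight l r t b"
proof -
  have "finite (UNIV :: tile set)" by (simp add: UNIV_tile)
  then have "card (fits l r t b) = (\<Sum>x\<in>UNIV. of_bool (x \<in> fits l r t b))"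
    by (simp add: sum_of_bool_eq)
  also have "int \<dots> = weight l r t b"
    by (cases l; cases r; cases t; cases b) (simp_all add: UNIV_tile fits_def weight_def)
  finally show ?thesis .
qed

section \<open>Peeling off the border\<close>

text \<open>Weight of a border tile: \<open>f\<close> is its edge towards the interior, \<open>a\<close> and \<open>b\<close> its two
  edges along the border.\<close>
definition link :: "bool \<Rightarrow> bool \<Rightarrow> bool \<Rightarrow> int" where
  "link f a b = of_bool (if f then a \<or> b else a = b)"

text \<open>A tile whose outer edge has no connection point cannot have four, so it counts 1 unless
  exactly one of the other three edges has one. The first argument of \<open>link\<close> is the
  edge opposite the outer one.\<close>

lemma weight_border:
  "weight False r t b = link r t b"
  "weight l False t b = link l t b"
  "weight l r False b = link b l r"
  "weight l r t False = link t l r"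
  by (auto simp: weight_def link_def)

text \<open>\<open>i\<close> and \<open>j\<close> hold the left and right edges, bit
  \<open>r\<close> for row \<open>r\<close> from the top; \<open>t\<close> and \<open>b\<close> are
  the edges at the upper and lower end.\<close>

definition column :: "nat \<Rightarrow> bool \<Rightarrow> bool \<Rightarrow> nat \<Rightarrow> nat \<Rightarrow> int" where
  "column m t b i j = walk UNIV (\<lambda>r. weight (bit i r) (bit j r)) m t b"

definition grid :: "nat \<Rightarrow> nat \<Rightarrow> nat \<Rightarrow> nat \<Rightarrow> nat \<Rightarrow> nat \<Rightarrow> int" where
  "grid m n L R T B = walk {..<2 ^ m} (\<lambda>c. column m (bit T c) (bit B c)) n L R"

definition border :: "nat \<Rightarrow> bool \<Rightarrow> bool \<Rightarrow> nat \<Rightarrow> int" where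
  "border k a b f = walk UNIV (\<lambda>r. link (bit f r)) k a b"

text \<open>Edge vector of a column two tiles taller: \<open>z\<close> and \<open>w\<close> are the
  ring edges in its top and bottom row, \<open>M\<close> the interior edges between them.\<close>

definition enlarge :: "nat \<Rightarrow> bool \<Rightarrow> nat \<Rightarrow> bool \<Rightarrow> nat" where
  "enlarge m z M w = of_bool z + 2 * (M + 2 ^ m * of_bool w)"

lemma bit_enlarge:
  assumes "M < 2 ^ m"
  shows "bit (enlarge m z M w) 0 = z"
    and "r < m \<Longrightarrow> bit (enlarge m z M w) (Suc r) = bit M r"
    and "bit (enlarge m z M w) (Suc m) = w"
proof -
  have *: "bit (enlarge m z M w) r = (if r < 1 then bit (of_bool z :: nat) r
      else bit (M + 2 ^ m * of_bool w) (r - 1))" for r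
  proof -
    have "of_bool z < (2::nat) ^ 1" by simp
    from bit_low_high[OF this, of "M + 2 ^ m * of_bool w" r] show ?thesis
      by (simp only: power_one_right enlarge_def)
  qed
  show "bit (enlarge m z M w) 0 = z" by (subst *) (simp add: bit_0)
  show "r < m \<Longrightarrow> bit (enlarge m z M w) (Suc r) = bit M r"
    using assms by (simp add: * bit_low_high)
  show "bit (enlarge m z M w) (Suc m) = w"
    using assms by (simp add: * bit_low_high bit_0)
qed

lemma sum_enlarge:
  fixes f :: "nat \<Rightarrow> 'a::comm_monoid_add"
  shows "(\<Sum>I<2 ^ (m + 2). f I) = (\<Sum>M<2 ^ m. \<Sum>(z, w)\<in>UNIV. f (enlarge m z M w))"
proof -
  have "(\<Sum>I<2 ^ (m + 2). f I) = (\<Sum>z\<in>UNIV. \<Sum>I<2 ^ Suc m. f (of_bool z + 2 * I))"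
    using sum_split_low_high[of f 1 "Suc m"]
    by (simp add: UNIV_bool lessThan_nat_numeral numeral_2_eq_2 add.commute)
  also have "\<dots> = (\<Sum>z\<in>UNIV. \<Sum>M<2 ^ m. \<Sum>w\<in>UNIV. f (enlarge m z M w))"
    by (simp only: sum_split_high_bit enlarge_def)
  also have "\<dots> = (\<Sum>M<2 ^ m. \<Sum>z\<in>UNIV. \<Sum>w\<in>UNIV. f (enlarge m z M w))"
    by (rule sum.swap)
  finally show ?thesis
    by (simp add: sum.cartesian_product UNIV_Times_UNIV[symmetric] del: UNIV_Times_UNIV)
qed

text \<open>The first and last tile have an empty outer edge and become links; the \<open>m\<close>
  tiles between form an ordinary column, whose end edges \<open>t\<close> and \<open>b\<close> face
  these border tiles.\<close>

lemma column_enlarge: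
  assumes "M < 2 ^ m" "M' < 2 ^ m"
  shows "column (m + 2) False False (enlarge m z M w) (enlarge m z' M' w') =
    (\<Sum>(t, b)\<in>UNIV. link t z z' * column m t b M M' * link b w w')"
proof -
  let ?A = "\<lambda>r. weight (bit (enlarge m z M w) r) (bit (enlarge m z' M' w') r)"
  have inner: "walk UNIV (\<lambda>r. ?A (Suc r)) m t b = column m t b M M'" for t b
    unfolding column_def using assms by (intro walk_cong) (simp add: bit_enlarge)
  have "column (m + 2) False False (enlarge m z M w) (enlarge m z' M' w') =
      (\<Sum>b\<in>UNIV. (\<Sum>t\<in>UNIV. ?A 0 False t * column m t b M M') * ?A (Suc m) b False)"
    unfolding column_def[of "m + 2"]
    by (simp only: add_2_eq_Suc' walk.simps(2)[of _ _ "Suc m"]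
        walk_Suc_left[OF finite_class.finite_UNIV UNIV_I UNIV_I] inner)
  also have "\<dots> = (\<Sum>b\<in>UNIV. \<Sum>t\<in>UNIV. link t z z' * column m t b M M' * link b w w')"
    using assms by (simp add: bit_enlarge weight_border sum_distrib_right)
  finally show ?thesis
    by (subst (asm) sum.swap)
      (simp add: sum.cartesian_product UNIV_Times_UNIV[symmetric] del: UNIV_Times_UNIV)
qed

lemma column_border:
  "column m t b 0 R = border m t b R" "column m t b L 0 = border m t b L"
  by (simp_all add: column_def border_def weight_border[abs_def])

text \<open>The outermost columns, corners included, are mere border strips:
  \<open>link t False z\<close> forces \<open>t = z\<close>, so a corner passes the ring state on
  unchanged.\<close>

lemma column_enlarge_border:
  assumes "M < 2 ^ m"
  shows "column (m + 2) False False 0 (enlarge m z M w) = border m z w M"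
    and "column (m + 2) False False (enlarge m z M w) 0 = border m z w M"
proof -
  have 0: "enlarge m False 0 False = 0" by (simp add: enlarge_def)
  show "column (m + 2) False False 0 (enlarge m z M w) = border m z w M"
    using column_enlarge[of 0 m M False False z w] assms
    by (cases z; cases w)
      (simp_all add: 0 column_border link_def UNIV_Times_UNIV[symmetric] UNIV_bool
        sum.cartesian_product[symmetric] del: UNIV_Times_UNIV)
  show "column (m + 2) False False (enlarge m z M w) 0 = border m z w M"
    using column_enlarge[of M m 0 z w False False] assms
    by (cases z; cases w)
      (simp_all add: 0 column_border link_def UNIV_Times_UNIV[symmetric] UNIV_bool
        sum.cartesian_product[symmetric] del: UNIV_Times_UNIV)
qed

lemma border_append:
  assumes "f < 2 ^ n"
  shows "border (Suc n) a b (f + 2 ^ n * of_bool t) = (\<Sum>c\<in>UNIV. border n a c f * link t c b)"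
proof -
  have "border n a c (f + 2 ^ n * of_bool t) = border n a c f" for c
    unfolding border_def using assms by (intro walk_cong) (simp add: bit_low_high)
  moreover have "bit (f + 2 ^ n * of_bool t) n = t"
    using assms by (simp only: bit_low_high) (simp add: bit_0)
  ultimately show ?thesis
    by (simp only: border_def[of "Suc n"] walk.simps border_def[symmetric])
qed

text \<open>The first \<open>n\<close> columns read only bits below \<open>n\<close>, so the new top
  bits \<open>t\<close> and \<open>b\<close> concern the last column alone. This is the block
  recursion of \<open>N_hat\<close> in terms of counts.\<close>

lemma grid_append:
  assumes "T < 2 ^ n" "B < 2 ^ n"
  shows "grid m (Suc n) L R (T + 2 ^ n * of_bool t) (B + 2 ^ n * of_bool b) =
    (\<Sum>M<2 ^ m. grid m n L M T B * column m t b M R)"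
proof -
  have "grid m n L M (T + 2 ^ n * of_bool t) (B + 2 ^ n * of_bool b) = grid m n L M T B" for M
    unfolding grid_def using assms by (intro walk_cong) (simp add: bit_low_high)
  moreover have "bit (T + 2 ^ n * of_bool t) n = t" "bit (B + 2 ^ n * of_bool b) n = b"
    using assms by (simp_all only: bit_low_high) (simp_all add: bit_0)
  ultimately show ?thesis
    by (simp only: grid_def[of _ "Suc n"] walk.simps grid_def[symmetric])
qed

text \<open>Weight of the left, top and bottom border strips; \<open>z\<close> and \<open>w\<close> are the states of the
  top and bottom ring edges at the still open right end.\<close>
definition open_border :: "nat \<Rightarrow> nat \<Rightarrow> nat \<Rightarrow> nat \<Rightarrow> nat \<Rightarrow> bool \<Rightarrow> bool \<Rightarrow> int" where
  "open_border m n L T B z w =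
    (\<Sum>(x, y)\<in>UNIV. border m x y L * border n x z T * border n y w B)"

lemma sum_bool_pair:
  fixes f :: "bool \<times> bool \<Rightarrow> 'a::comm_monoid_add"
  shows "sum f UNIV = f (False, False) + f (False, True) + f (True, False) + f (True, True)"
  by (simp add: UNIV_Times_UNIV[symmetric] UNIV_bool sum.cartesian_product'
        add.assoc del: UNIV_Times_UNIV)

lemma open_border_append:
  assumes "T < 2 ^ n" "B < 2 ^ n"
  shows "open_border m (Suc n) L (T + 2 ^ n * of_bool t) (B + 2 ^ n * of_bool b) z w =
    (\<Sum>(z', w')\<in>UNIV. open_border m n L T B z' w' * (link t z' z * link b w' w))"
  unfolding open_border_def border_append[OF assms(1)] border_append[OF assms(2)]
  by (simp add: sum_bool_pair UNIV_bool algebra_simps)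

text \<open>Left border column plus \<open>n\<close> further columns, open on the right. Every
  further column splits into a top border tile, an interior column and a bottom border tile, which
  extend \<open>open_border\<close> and \<open>grid\<close> separately.\<close>

lemma grid_open_border:
  assumes "R < 2 ^ m"
  shows "grid (m + 2) (Suc n) 0 (enlarge m z R w) 0 0 =
    (\<Sum>L<2 ^ m. \<Sum>T<2 ^ n. \<Sum>B<2 ^ n. grid m n L R T B * open_border m n L T B z w)"
  using assms
proof (induction n arbitrary: R z w)
  case 0
  have "grid (m + 2) (Suc 0) 0 (enlarge m z R w) 0 0 = column (m + 2) False False 0 (enlarge m z R w)"
    by (simp add: grid_def of_bool_def if_distrib[of "\<lambda>u. u * _"] cong: if_cong)
  also have "\<dots> = border m z w R" using 0 by (rule column_enlarge_border)
  \<comment> \<open>The top and bottom strips are still empty and act as the identity, so the ends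
    of the left strip are \<open>z\<close> and \<open>w\<close>.\<close>
  also have "\<dots> = open_border m 0 R 0 0 z w"
    by (cases z; cases w) (simp_all add: open_border_def border_def sum_bool_pair)
  finally show ?case
    using 0 by (simp add: grid_def of_bool_def if_distrib[of "\<lambda>u. u * _"] cong: if_cong)
next
  case (Suc n)
  \<comment> \<open>The three outer indices are bundled into one so that each exchange of sums is
    done once.\<close>
  define P where "P = {..<2 ^ m :: nat} \<times> {..<2 ^ n :: nat} \<times> {..<2 ^ n :: nat}"
  define g where "g M = (\<lambda>(L, T, B). grid m n L M T B)" for M
  define h where "h z w = (\<lambda>(L, T, B). open_border m n L T B z w)" for z w
  have P_I: "(\<Sum>L<2 ^ m. \<Sum>T<2 ^ n. \<Sum>B<2 ^ n. F L T B) = (\<Sum>(L, T, B)\<in>P. F L T B)"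
    for F :: "nat \<Rightarrow> nat \<Rightarrow> nat \<Rightarrow> int"
    by (simp add: P_def sum.cartesian_product)
  have IH: "grid (m + 2) (Suc n) 0 (enlarge m z' M w') 0 0 = (\<Sum>p\<in>P. g M p * h z' w' p)"
    if "M < 2 ^ m" for M z' w'
    unfolding Suc.IH[OF that] P_I g_def h_def by (simp add: case_prod_beta)
  have "grid (m + 2) (Suc (Suc n)) 0 (enlarge m z R w) 0 0 =
      (\<Sum>M<2 ^ m. \<Sum>(z', w')\<in>UNIV. grid (m + 2) (Suc n) 0 (enlarge m z' M w') 0 0 *
         column (m + 2) False False (enlarge m z' M w') (enlarge m z R w))"
    unfolding grid_def[of _ "Suc (Suc n)"] walk.simps(2)[of _ _ "Suc n"] grid_def[symmetric] sum_enlarge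
    by simp
  also have "\<dots> = (\<Sum>M<2 ^ m. \<Sum>(z', w')\<in>UNIV. (\<Sum>p\<in>P. g M p * h z' w' p) *
         (\<Sum>(t, b)\<in>UNIV. link t z' z * column m t b M R * link b w' w))"
    using Suc.prems by (intro sum.cong refl) (auto simp del: add_2_eq_Suc' simp: IH column_enlarge split: prod.splits)
  also have "\<dots> = (\<Sum>M<2 ^ m. \<Sum>p\<in>P. \<Sum>(z', w')\<in>UNIV. g M p * h z' w' p *
         (\<Sum>(t, b)\<in>UNIV. link t z' z * column m t b M R * link b w' w))"
    by (subst (2) sum.swap) (simp add: sum_distrib_right case_prod_beta)
  also have "\<dots> = (\<Sum>p\<in>P. \<Sum>M<2 ^ m. \<Sum>(t, b)\<in>UNIV. g M p * column m t b M R *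
         (\<Sum>(z', w')\<in>UNIV. h z' w' p * (link t z' z * link b w' w)))"
    by (subst sum.swap) (simp add: sum_bool_pair algebra_simps)
  \<comment> \<open>For fixed \<open>t\<close> and \<open>b\<close> the summand factors: only the
    interior depends on \<open>M\<close>, only the ring on \<open>z'\<close> and
    \<open>w'\<close>.\<close>
  also have "\<dots> = (\<Sum>p\<in>P. \<Sum>(t, b)\<in>UNIV. (\<Sum>M<2 ^ m. g M p * column m t b M R) *
         (\<Sum>(z', w')\<in>UNIV. h z' w' p * (link t z' z * link b w' w)))"
    by (intro sum.cong refl, subst sum.swap) (simp add: sum_distrib_right case_prod_beta)
  also have "\<dots> = (\<Sum>(L, T, B)\<in>P. \<Sum>(t, b)\<in>UNIV.
         grid m (Suc n) L R (T + 2 ^ n * of_bool t) (B + 2 ^ n * of_bool b) *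
         open_border m (Suc n) L (T + 2 ^ n * of_bool t) (B + 2 ^ n * of_bool b) z w)"
    by (intro sum.cong refl)
      (auto simp: P_def g_def h_def grid_append open_border_append split: prod.splits)
  also have "\<dots> = (\<Sum>L<2 ^ m. \<Sum>T<2 ^ n. \<Sum>B<2 ^ n. \<Sum>t\<in>UNIV. \<Sum>b\<in>UNIV.
         grid m (Suc n) L R (T + 2 ^ n * of_bool t) (B + 2 ^ n * of_bool b) *
         open_border m (Suc n) L (T + 2 ^ n * of_bool t) (B + 2 ^ n * of_bool b) z w)"
    unfolding P_I by (simp add: sum.cartesian_product UNIV_Times_UNIV[symmetric] del: UNIV_Times_UNIV)
  \<comment> \<open>\<open>t\<close> and \<open>b\<close> become the top bits of the longer vectors
    \<open>T\<close> and \<open>B\<close>.\<close>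
  also have "\<dots> = (\<Sum>L<2 ^ m. \<Sum>T<2 ^ Suc n. \<Sum>B<2 ^ Suc n.
         grid m (Suc n) L R T B * open_border m (Suc n) L T B z w)"
    unfolding sum_split_high_bit by (subst (3) sum.swap) (rule refl)
  finally show ?case .
qed

section \<open>Fibonacci powers and Lucas numbers\<close>

text \<open>Powers of the matrix [[0,1],[1,1]], with \<open>False\<close> as the first
  index.\<close>

definition fib_power :: "nat \<Rightarrow> bool \<Rightarrow> bool \<Rightarrow> int" where
  "fib_power k = walk UNIV (\<lambda>_. link True) k"

lemma fib_power_simps:
  "fib_power 0 a b = of_bool (a = b)"
  "fib_power (Suc k) a b = (if b then fib_power k a False + fib_power k a True else fib_power k a True)"
  by (auto simp: fib_power_def UNIV_bool link_def)

lemma fib_power_add: "fib_power (j + k) a c = (\<Sum>b\<in>UNIV. fib_power j a b * fib_power k b c)"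
proof (induction k arbitrary: c)
  case 0
  show ?case by (cases c) (simp_all add: fib_power_simps UNIV_bool)
next
  case (Suc k)
  then show ?case by (cases c) (simp_all add: fib_power_simps UNIV_bool algebra_simps)
qed

text \<open>The recursion multiplies on the right only, so symmetry is not inductive by itself; the
  Fibonacci relation between the entries is carried along.\<close>

lemma fib_power_sym: "fib_power k a b = fib_power k b a"
proof -
  have "fib_power k True False = fib_power k False True \<and>
    fib_power k True True = fib_power k False False + fib_power k False True"
    by (induction k) (auto simp: fib_power_simps)
  then show ?thesis by (cases a; cases b) auto
qed

text \<open>(1 + sqrt 5) / 2 and (1 - sqrt 5) / 2 are the roots of x^2 = x + 1; the proof uses this
  equation with denominators cleared.\<close>

lemma lucas_rec: "lucas (Suc (Suc k)) = lucas (Suc k) + lucas k"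
proof -
  have "(1 + sqrt 5) ^ 2 = 2 * (1 + sqrt 5) + 4" "(1 - sqrt 5) ^ 2 = 2 * (1 - sqrt 5) + 4"
    by (simp_all add: power2_eq_square algebra_simps)
  then have "(1 + sqrt 5) ^ Suc (Suc k) = (2 * (1 + sqrt 5) + 4) * (1 + sqrt 5) ^ k"
    "(1 - sqrt 5) ^ Suc (Suc k) = (2 * (1 - sqrt 5) + 4) * (1 - sqrt 5) ^ k"
    by (simp_all only: power2_eq_square power_Suc mult.assoc[symmetric])
  then show ?thesis
    unfolding lucas_def by (simp only:) (simp add: field_simps)
qed

text \<open>The matrix satisfies M^2 = M + I, so the traces of its powers obey the Lucas recurrence;
  they start with 2 and 1.\<close>

lemma fib_power_trace: "real_of_int (fib_power k False False + fib_power k True True) = lucas k"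
proof (induction k rule: nat_less_induct)
  case (1 k)
  consider "k = 0" | "k = 1" | j where "k = Suc (Suc j)"
    by (cases k; cases "k - 1") auto
  then show ?case
  proof cases
    case 3
    have "lucas k = real_of_int (fib_power (Suc j) False False + fib_power (Suc j) True True) +
        real_of_int (fib_power j False False + fib_power j True True)"
      using 1 3 lucas_rec[of j] by simp
    then show ?thesis
      unfolding 3 using fib_power_sym[of j True False] by (simp add: fib_power_simps)
  qed (simp_all add: lucas_def fib_power_simps)
qed

text \<open>Tiles facing an empty edge act as the identity, so only the number of set bits matters,
  not their positions.\<close>

lemma border_eq_fib_power: "border k a b f = fib_power (card {r. r < k \<and> bit f r}) a b"
proof (induction k arbitrary: b)
  case 0
  show ?case by (simp add: border_def fib_power_simps)
next
  case (Suc k)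
  have "{r. r < Suc k \<and> bit f r} = (if bit f k then insert k else id) {r. r < k \<and> bit f r}"
    by (auto simp: less_Suc_eq)
  then show ?case
    using Suc by (cases b) (auto simp: border_def fib_power_simps UNIV_bool link_def)
qed

lemma border_hamming:
  assumes "f < 2 ^ k"
  shows "border k a b f = fib_power (hamming_weight f) a b"
proof -
  have "{r. r < k \<and> bit f r} = {r. bit f r}"
    using assms bit_high_false not_less by blast
  then show ?thesis by (simp add: border_eq_fib_power hamming_weight_def)
qed

lemma finite_bits: "finite {r. bit (f :: nat) r}"
proof -
  have "{r. bit f r} \<subseteq> {..<f}"
    using bit_high_false[OF less_exp, of f] not_less by blast
  then show ?thesis by (rule finite_subset) simp
qed

lemma hamming_weight_low_high:
  assumes "L < 2 ^ m"
  shows "hamming_weight (L + 2 ^ m * T) = hamming_weight L + hamming_weight T"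
proof -
  have "{r. bit (L + 2 ^ m * T) r} = {r. bit L r} \<union> (\<lambda>r. r + m) ` {r. bit T r}"
  proof (rule Set.set_eqI)
    fix r
    show "r \<in> {r. bit (L + 2 ^ m * T) r} \<longleftrightarrow> r \<in> {r. bit L r} \<union> (\<lambda>r. r + m) ` {r. bit T r}"
      using bit_high_false[OF assms, of r]
      by (cases "r < m") (auto simp: bit_low_high[OF assms] image_iff intro!: exI[of _ "r - m"])
  qed
  moreover have "{r. bit L r} \<inter> (\<lambda>r. r + m) ` {r. bit T r} = {}"
    using bit_high_false[OF assms] by auto
  ultimately show ?thesis
    unfolding hamming_weight_def
    by (simp add: card_Un_disjoint finite_bits card_image inj_on_def)
qed

text \<open>The four strips close up to a ring, and summing over all four corner states gives the
  trace of one Fibonacci power.\<close>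

lemma closed_border:
  assumes "L < 2 ^ m" "R < 2 ^ m" "T < 2 ^ n" "B < 2 ^ n"
  shows "real_of_int (\<Sum>(z, w)\<in>UNIV. open_border m n L T B z w * border m z w R) =
    lucas (hamming_weight L + hamming_weight T + hamming_weight R + hamming_weight B)"
proof -
  let ?l = "hamming_weight L" and ?r = "hamming_weight R"
    and ?t = "hamming_weight T" and ?b = "hamming_weight B"
  \<comment> \<open>Going round as left, bottom, right, top traverses the last two strips backwards,
    which symmetry of the powers permits.\<close>
  have "(\<Sum>(z, w)\<in>UNIV. open_border m n L T B z w * border m z w R) =
      fib_power (?l + ?b + ?r + ?t) False False + fib_power (?l + ?b + ?r + ?t) True True"
    unfolding open_border_def border_hamming[OF assms(1)] border_hamming[OF assms(2)]
      border_hamming[OF assms(3)] border_hamming[OF assms(4)] fib_power_add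
    using fib_power_sym[of ?l True False] fib_power_sym[of ?r True False]
      fib_power_sym[of ?t True False] fib_power_sym[of ?b True False]
    by (simp add: sum_bool_pair UNIV_bool algebra_simps)
  then show ?thesis
    by (simp only: fib_power_trace) (simp add: ac_simps)
qed

text \<open>The right border column closes the ring that \<open>grid_open_border\<close> leaves
  open.\<close>

lemma grid_border:
  "real_of_int (grid (m + 2) (n + 2) 0 0 0 0) =
    (\<Sum>L<2 ^ m. \<Sum>T<2 ^ n. \<Sum>R<2 ^ m. \<Sum>B<2 ^ n.
      lucas (hamming_weight L + hamming_weight T + hamming_weight R + hamming_weight B) *
      real_of_int (grid m n L R T B))"
proof -
  have "grid (m + 2) (n + 2) 0 0 0 0 =
      (\<Sum>I<2 ^ (m + 2). grid (m + 2) (Suc n) 0 I 0 0 * column (m + 2) False False I 0)"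
    unfolding grid_def add_2_eq_Suc'[of n] walk.simps(2)[of _ _ "Suc n"] by simp
  also have "\<dots> = (\<Sum>R<2 ^ m. \<Sum>(z, w)\<in>UNIV.
      (\<Sum>L<2 ^ m. \<Sum>T<2 ^ n. \<Sum>B<2 ^ n. grid m n L R T B * open_border m n L T B z w) * border m z w R)"
    unfolding sum_enlarge
    by (intro sum.cong refl)
      (auto simp del: add_2_eq_Suc' simp: grid_open_border column_enlarge_border split: prod.splits)
  also have "\<dots> = (\<Sum>R<2 ^ m. \<Sum>L<2 ^ m. \<Sum>T<2 ^ n. \<Sum>B<2 ^ n.
      (\<Sum>(z, w)\<in>UNIV. open_border m n L T B z w * border m z w R) * grid m n L R T B)"
    by (simp add: sum_bool_pair sum_distrib_left sum_distrib_right sum.distrib algebra_simps)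
  finally have "real_of_int (grid (m + 2) (n + 2) 0 0 0 0) = (\<Sum>R<2 ^ m. \<Sum>L<2 ^ m. \<Sum>T<2 ^ n. \<Sum>B<2 ^ n.
      real_of_int (\<Sum>(z, w)\<in>UNIV. open_border m n L T B z w * border m z w R) *
      real_of_int (grid m n L R T B))"
    by simp
  also have "\<dots> = (\<Sum>R<2 ^ m. \<Sum>L<2 ^ m. \<Sum>T<2 ^ n. \<Sum>B<2 ^ n.
      lucas (hamming_weight L + hamming_weight T + hamming_weight R + hamming_weight B) *
      real_of_int (grid m n L R T B))"
    by (intro sum.cong refl) (simp only: closed_border lessThan_iff)
  also have "\<dots> = (\<Sum>L<2 ^ m. \<Sum>T<2 ^ n. \<Sum>R<2 ^ m. \<Sum>B<2 ^ n.
      lucas (hamming_weight L + hamming_weight T + hamming_weight R + hamming_weight B) *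
      real_of_int (grid m n L R T B))"
    by (subst sum.swap, rule sum.cong[OF refl], rule sum.swap)
  finally show ?thesis .
qed

section \<open>State matrices as tables of grid counts\<close>

lemma column_Suc:
  "column (Suc k) t b i j = (\<Sum>c\<in>UNIV. column k t c i j * weight (bit i k) (bit j k) c b)"
  by (simp add: column_def)

lemma column_low:
  assumes "\<And>r. r < k \<Longrightarrow> bit i r = bit i' r" "\<And>r. r < k \<Longrightarrow> bit j r = bit j' r"
  shows "column k t b i j = column k t b i' j'"
  unfolding column_def using assms by (intro walk_cong) simp

lemma state_matrix_carrier:
  "Xp k \<in> carrier_mat (2 ^ k) (2 ^ k)" "Xm k \<in> carrier_mat (2 ^ k) (2 ^ k)"
  "Op k \<in> carrier_mat (2 ^ k) (2 ^ k)" "Om k \<in> carrier_mat (2 ^ k) (2 ^ k)"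
proof -
  have "Xp k \<in> carrier_mat (2 ^ k) (2 ^ k) \<and> Xm k \<in> carrier_mat (2 ^ k) (2 ^ k) \<and>
    Op k \<in> carrier_mat (2 ^ k) (2 ^ k) \<and> Om k \<in> carrier_mat (2 ^ k) (2 ^ k)"
    by (induction k) (auto simp: four_block_mat_def Let_def)
  then show "Xp k \<in> carrier_mat (2 ^ k) (2 ^ k)" "Xm k \<in> carrier_mat (2 ^ k) (2 ^ k)"
    "Op k \<in> carrier_mat (2 ^ k) (2 ^ k)" "Om k \<in> carrier_mat (2 ^ k) (2 ^ k)" by auto
qed

lemma bit_top:
  assumes "i < 2 ^ Suc k"
  shows "bit i k \<longleftrightarrow> \<not> (i::nat) < 2 ^ k"
    and "\<not> i < 2 ^ k \<Longrightarrow> r < k \<Longrightarrow> bit (i - 2 ^ k) r = bit i r"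
proof -
  have eq: "i = (i - 2 ^ k) + 2 ^ k * 1" if "\<not> i < 2 ^ k" using that by simp
  have lt: "i - 2 ^ k < 2 ^ k" if "\<not> i < 2 ^ k" using assms that by simp
  show "bit i k \<longleftrightarrow> \<not> i < 2 ^ k"
    using bit_high_false[of i k k] eq lt bit_low_high[OF lt, of 1 k] by (cases "i < 2 ^ k") (auto simp: bit_0)
  show "\<not> i < 2 ^ k \<Longrightarrow> r < k \<Longrightarrow> bit (i - 2 ^ k) r = bit i r"
    using eq bit_low_high[OF lt, of 1 r] by simp
qed

text \<open>The blocks are selected by bit \<open>k\<close> of \<open>i\<close> and
  \<open>j\<close>, the edges of the new bottom tile, and their coefficients are its weights. The
  upper end stays fixed, so \<open>Xp\<close> mixes only with \<open>Om\<close> and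
  \<open>Xm\<close> only with \<open>Op\<close>.\<close>

lemma state_matrix_index:
  assumes "i < 2 ^ k" "j < 2 ^ k"
  shows "Xp k $$ (i, j) = column k False False i j"
    and "Xm k $$ (i, j) = column k True False i j"
    and "Op k $$ (i, j) = column k True True i j"
    and "Om k $$ (i, j) = column k False True i j"
proof -
  have "Xp k $$ (i, j) = column k False False i j \<and> Xm k $$ (i, j) = column k True False i j \<and>
    Op k $$ (i, j) = column k True True i j \<and> Om k $$ (i, j) = column k False True i j"
    using assms
  proof (induction k arbitrary: i j)
    case 0
    then show ?case by (simp add: column_def)
  next
    case (Suc k)
    \<comment> \<open>The position inside the block, obtained by clearing bit
      \<open>k\<close>.\<close>
    define i' where "i' = (if i < 2 ^ k then i else i - 2 ^ k)"
    define j' where "j' = (if j < 2 ^ k then j else j - 2 ^ k)"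
    have lt: "i' < 2 ^ k" "j' < 2 ^ k" using Suc.prems by (auto simp: i'_def j'_def)
    have low: "column k t b i j = column k t b i' j'" for t b
      using Suc.prems by (intro column_low) (auto simp: i'_def j'_def bit_top(2))
    note [simp] = state_matrix_carrier[THEN carrier_matD(1)] state_matrix_carrier[THEN carrier_matD(2)]
    show ?case
      using Suc.prems lt Suc.IH[OF lt]
      unfolding column_Suc low bit_top(1)[OF Suc.prems(1)] bit_top(1)[OF Suc.prems(2)]
      by (cases "i < 2 ^ k"; cases "j < 2 ^ k") (auto simp: UNIV_bool weight_def i'_def j'_def)
  qed
  then show "Xp k $$ (i, j) = column k False False i j" "Xm k $$ (i, j) = column k True False i j"
    "Op k $$ (i, j) = column k True True i j" "Om k $$ (i, j) = column k False True i j" by auto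
qed

lemma low_high_less:
  fixes L :: nat
  assumes "L < 2 ^ m" "T < 2 ^ k"
  shows "L + 2 ^ m * T < 2 ^ (m + k)"
proof -
  have "L + 2 ^ m * T < 2 ^ m * Suc T" using assms by simp
  also have "\<dots> \<le> 2 ^ m * 2 ^ k" using assms by (intro mult_left_mono) auto
  finally show ?thesis by (simp add: power_add)
qed

text \<open>The second factor is block diagonal: it keeps the high part \<open>B\<close> of the
  column index and acts by \<open>A\<close> on the low part.\<close>

lemma mult_kronecker_one_index:
  assumes N: "N \<in> carrier_mat (2 ^ (m + k)) (2 ^ (m + k))" and A: "A \<in> carrier_mat (2 ^ m) (2 ^ m)"
    and i: "i < 2 ^ (m + k)" and R: "R < 2 ^ m" and B: "B < 2 ^ k"
  shows "(N * (Idm k \<otimes>\<^sub>K A)) $$ (i, R + 2 ^ m * B) =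
    (\<Sum>M<2 ^ m. N $$ (i, M + 2 ^ m * B) * A $$ (M, R))"
proof -
  note lt = low_high_less[OF R B]
  have "(N * (Idm k \<otimes>\<^sub>K A)) $$ (i, R + 2 ^ m * B) =
      (\<Sum>l<2 ^ (m + k). N $$ (i, l) * (Idm k \<otimes>\<^sub>K A) $$ (l, R + 2 ^ m * B))"
    using N A i lt
    by (simp add: scalar_prod_def kronecker_def atLeast0LessThan power_add mult.commute)
  also have "\<dots> = (\<Sum>M<2 ^ m. \<Sum>C<2 ^ k.
      N $$ (i, M + 2 ^ m * C) * (if C = B then A $$ (M, R) else 0))"
    unfolding sum_split_low_high
  proof (intro sum.cong refl)
    fix M C :: nat assume "M \<in> {..<2 ^ m}" "C \<in> {..<2 ^ k}"
    then have "(Idm k \<otimes>\<^sub>K A) $$ (M + 2 ^ m * C, R + 2 ^ m * B) = (if C = B then A $$ (M, R) else 0)"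
      using A R B lt low_high_less[of M m C k] by (simp add: kronecker_def power_add mult.commute)
    then show "N $$ (i, M + 2 ^ m * C) * (Idm k \<otimes>\<^sub>K A) $$ (M + 2 ^ m * C, R + 2 ^ m * B) =
      N $$ (i, M + 2 ^ m * C) * (if C = B then A $$ (M, R) else 0)" by simp
  qed
  also have "\<dots> = (\<Sum>M<2 ^ m. N $$ (i, M + 2 ^ m * B) * A $$ (M, R))"
    using B by (simp add: if_distrib[of "\<lambda>u. _ * u"] cong: if_cong)
  finally show ?thesis .
qed

lemma N_hat_carrier: "N_hat m k \<in> carrier_mat (2 ^ (m + k)) (2 ^ (m + k))"
  by (induction k) (auto simp: kronecker_def state_matrix_carrier[THEN carrier_matD(2)] power_add mult.commute)

lemma less_power_SucE:
  assumes "T < 2 ^ Suc k"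
  obtains T' t where "T' < (2::nat) ^ k" "T = T' + 2 ^ k * of_bool t"
proof (cases "T < 2 ^ k")
  case True
  then show ?thesis using that[of T False] by simp
next
  case False
  then show ?thesis using that[of "T - 2 ^ k" True] assms by simp
qed

text \<open>A new column adds \<open>t\<close> as top bit of the row index and \<open>b\<close> as
  top bit of the column index, which select the block; its factor counts columns with end edges
  \<open>t\<close> and \<open>b\<close>.\<close>

lemma N_hat_index:
  assumes "L < 2 ^ m" "R < 2 ^ m" "T < 2 ^ k" "B < 2 ^ k"
  shows "N_hat m k $$ (L + 2 ^ m * T, R + 2 ^ m * B) = grid m k L R T B"
  using assms
proof (induction k arbitrary: R T B)
  case 0
  then show ?case by (auto simp: grid_def)
next
  case (Suc k)
  obtain T' t where T: "T' < 2 ^ k" "T = T' + 2 ^ k * of_bool t" using less_power_SucE[OF Suc.prems(3)] .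
  obtain B' b where B: "B' < 2 ^ k" "B = B' + 2 ^ k * of_bool b" using less_power_SucE[OF Suc.prems(4)] .
  define A where "A = (if t then if b then Op m else Xm m else if b then Om m else Xp m)"
  have A: "A \<in> carrier_mat (2 ^ m) (2 ^ m)" by (simp add: A_def state_matrix_carrier)
  have lt: "L + 2 ^ m * T' < 2 ^ (m + k)" "R + 2 ^ m * B' < 2 ^ (m + k)"
    using Suc.prems T B by (auto intro: low_high_less)
  have dims: "dim_row (N_hat m k) = 2 ^ (m + k)" "dim_col (N_hat m k) = 2 ^ (m + k)"
    using N_hat_carrier[of m k] by auto
  have "N_hat m (Suc k) $$ (L + 2 ^ m * T, R + 2 ^ m * B) =
      (N_hat m k * (Idm k \<otimes>\<^sub>K A)) $$ (L + 2 ^ m * T', R + 2 ^ m * B')"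
    using lt by (cases t; cases b)
      (simp_all add: T B A_def dims kronecker_def state_matrix_carrier[THEN carrier_matD(1)]
        state_matrix_carrier[THEN carrier_matD(2)] power_add algebra_simps)
  also have "\<dots> = (\<Sum>M<2 ^ m. N_hat m k $$ (L + 2 ^ m * T', M + 2 ^ m * B') * A $$ (M, R))"
    using Suc.prems B(1) lt by (intro mult_kronecker_one_index N_hat_carrier A)
  also have "\<dots> = (\<Sum>M<2 ^ m. grid m k L M T' B' * column m t b M R)"
    using Suc.prems T(1) B(1)
    by (intro sum.cong refl) (auto simp: Suc.IH A_def state_matrix_index)
  finally show ?case using T B by (simp only: grid_append)
qed

section \<open>Counting mosaics\<close>

definition columns :: "nat \<Rightarrow> bool \<Rightarrow> bool \<Rightarrow> nat \<Rightarrow> nat \<Rightarrow> (nat \<Rightarrow> tile) set" where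
  "columns m t b i j = walks UNIV (\<lambda>r. fits (bit i r) (bit j r)) m t b"

definition grids :: "nat \<Rightarrow> nat \<Rightarrow> (nat \<Rightarrow> nat \<Rightarrow> tile) set" where
  "grids m n = walks {..<2 ^ m} (\<lambda>_. columns m False False) n 0 0"

text \<open>A tile determines its top edge, so \<open>card_walks\<close> applies.\<close>

lemma card_columns: "finite (columns m t b i j) \<and> int (card (columns m t b i j)) = column m t b i j"
  unfolding columns_def column_def card_fits[symmetric]
  by (rule card_walks) (auto simp: finite_fits, auto simp: fits_def)

lemma columns_left: "c \<in> columns m t b i j \<Longrightarrow> r < m \<Longrightarrow> bit i r = (LeftSide \<in> connection_points (c r))"
  by (auto simp: columns_def walks_def fits_def)

lemma card_grids: "int (card (grids m n)) = grid m n 0 0 0 0"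
proof -
  \<comment> \<open>A column of tiles determines its left edge vector: its tiles give the bits below
    \<open>m\<close>, and the bound \<open>2 ^ m\<close> excludes all others.\<close>
  have "i = i'" if "c \<in> columns m t b i j" "c \<in> columns m t b i' j" "i < 2 ^ m" "i' < 2 ^ m" for c t b i i' j
  proof (rule bit_eqI)
    fix r
    show "bit i r = bit i' r"
      using columns_left[OF that(1), of r] columns_left[OF that(2), of r] bit_high_false[OF that(3), of r]
        bit_high_false[OF that(4), of r] by (cases "r < m") auto
  qed
  then have "int (card (grids m n)) =
      walk {..<2 ^ m} (\<lambda>_ x y. int (card (columns m False False x y))) n 0 0"
    unfolding grids_def
    by (intro card_walks[THEN conjunct2]) (simp, simp add: card_columns, simp)
  then show ?thesis
    by (simp add: card_columns grid_def)
qed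

section \<open>Walks of tiles as suitably connected arrays\<close>

lemma ex_bits: "\<exists>x < 2 ^ k. \<forall>r < k. bit (x::nat) r = P r"
proof (intro exI conjI allI impI)
  let ?x = "horner_sum of_bool 2 (map P [0..<k]) :: nat"
  show "?x < 2 ^ k" using horner_sum_of_bool_2_less[of "map P [0..<k]"] by simp
  show "bit ?x r = P r" if "r < k" for r using that by (simp add: bit_horner_sum_bit_iff)
qed

abbreviation at_side :: "side \<Rightarrow> tile \<Rightarrow> bool" where
  "at_side s x \<equiv> s \<in> connection_points x"

lemma in_columns_iff:
  "c \<in> columns m False False i j \<longleftrightarrow> c \<in> extensional {..<m} \<and>
    (\<forall>r<m. at_side LeftSide (c r) = bit i r \<and> at_side RightSide (c r) = bit j r) \<and>
    (\<forall>r. Suc r < m \<longrightarrow> at_side BottomSide (c r) = at_side TopSide (c (Suc r))) \<and>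
    (m > 0 \<longrightarrow> \<not> at_side TopSide (c 0) \<and> \<not> at_side BottomSide (c (m - 1)))"
  (is "_ \<longleftrightarrow> ?rhs")
proof
  assume "c \<in> columns m False False i j"
  then obtain v where c: "c \<in> extensional {..<m}" and v: "\<not> v 0" "\<not> v m"
    "\<And>r. r < m \<Longrightarrow> c r \<in> fits (bit i r) (bit j r) (v r) (v (Suc r))"
    unfolding columns_def walks_def by auto
  have "at_side BottomSide (c r) = at_side TopSide (c (Suc r))" if "Suc r < m" for r
    using v(3)[of r] v(3)[of "Suc r"] that by (auto simp: fits_def)
  moreover have "\<not> at_side TopSide (c 0) \<and> \<not> at_side BottomSide (c (m - 1))" if "m > 0"
    using v(3)[of 0] v(3)[of "m - 1"] v(1,2) that by (auto simp: fits_def)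
  ultimately show ?rhs using c v(3) by (auto simp: fits_def)
next
  assume rhs: ?rhs
  \<comment> \<open>The state before tile \<open>r\<close> is its top edge; the guard
    \<open>r < m\<close> makes the state after the last tile \<open>False\<close>.\<close>
  define v where "v r = (r < m \<and> at_side TopSide (c r))" for r
  have "c r \<in> fits (bit i r) (bit j r) (v r) (v (Suc r))" if "r < m" for r
  proof (cases "Suc r < m")
    case True
    then show ?thesis using rhs that by (auto simp: fits_def v_def)
  next
    case False
    with that have "r = m - 1" by simp
    then show ?thesis using rhs that by (auto simp: fits_def v_def)
  qed
  moreover have "v 0 = False" "v m = False" using rhs by (auto simp: v_def)
  ultimately show "c \<in> columns m False False i j"
    using rhs by (auto simp: columns_def walks_def)
qed

lemma in_grids_iff:
  assumes "n > 0"
  shows "f \<in> grids m n \<longleftrightarrow> f \<in> extensional {..<n} \<and> (\<forall>c<n. f c \<in> extensional {..<m}) \<and>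
    (\<forall>c r. c < n \<and> Suc r < m \<longrightarrow> at_side BottomSide (f c r) = at_side TopSide (f c (Suc r))) \<and>
    (\<forall>c r. Suc c < n \<and> r < m \<longrightarrow> at_side RightSide (f c r) = at_side LeftSide (f (Suc c) r)) \<and>
    (\<forall>c<n. m > 0 \<longrightarrow> \<not> at_side TopSide (f c 0) \<and> \<not> at_side BottomSide (f c (m - 1))) \<and>
    (\<forall>r<m. \<not> at_side LeftSide (f 0 r) \<and> \<not> at_side RightSide (f (n - 1) r))"
  (is "_ \<longleftrightarrow> ?rhs")
proof
  assume "f \<in> grids m n"
  then obtain v where f: "f \<in> extensional {..<n}" and v: "v 0 = 0" "v n = 0"
    "\<And>c. c < n \<Longrightarrow> f c \<in> columns m False False (v c) (v (Suc c))"
    unfolding grids_def walks_def by auto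
  note v3 = v(3)[unfolded in_columns_iff]
  have "at_side RightSide (f c r) = at_side LeftSide (f (Suc c) r)" if "Suc c < n" "r < m" for c r
    using v3[of c] v3[of "Suc c"] that by simp
  moreover have "\<not> at_side LeftSide (f 0 r) \<and> \<not> at_side RightSide (f (n - 1) r)" if "r < m" for r
    using v3[of 0] v3[of "n - 1"] v(1,2) that assms by simp
  ultimately show ?rhs using f v3 by auto
next
  assume rhs: ?rhs
  have "\<exists>x < 2 ^ m. \<forall>r < m. bit (x::nat) r = (c < n \<and> at_side LeftSide (f c r))" for c
    by (rule ex_bits)
  then obtain w where w: "\<And>c. w c < 2 ^ m"
    "\<And>c r. r < m \<Longrightarrow> bit (w c :: nat) r = (c < n \<and> at_side LeftSide (f c r))"
    by metis
  \<comment> \<open>Both end states are set to 0, which agrees with the tiles since the outer left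
    and right edges have no connection points.\<close>
  define v where "v c = (if c = 0 \<or> c = n then 0 else w c)" for c
  have left: "bit (v c) r = at_side LeftSide (f c r)" if "c < n" "r < m" for c r
    using that rhs by (auto simp: v_def w(2))
  have right: "bit (v (Suc c)) r = at_side RightSide (f c r)" if "c < n" "r < m" for c r
  proof (cases "Suc c = n")
    case True
    then have "c = n - 1" by simp
    then show ?thesis using True rhs that by (auto simp: v_def)
  next
    case False
    then show ?thesis using left[of "Suc c" r] rhs that by auto
  qed
  have "f c \<in> columns m False False (v c) (v (Suc c))" if "c < n" for c
    unfolding in_columns_iff using rhs that by (auto simp: left right)
  moreover have "v 0 = 0" "v n = 0" "v c < 2 ^ m" for c using w(1) by (auto simp: v_def)
  ultimately show "f \<in> grids m n"
    using rhs by (auto simp: grids_def walks_def intro!: exI[of _ v])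
qed

lemma D_G_eq_grid:
  assumes "p > 0" "q > 0"
  shows "int (D_G p q) = grid p q 0 0 0 0"
proof -
  \<comment> \<open>Fillings take the column first, matrices the row first. \<open>?from\<close>
    restricts both arguments to land among extensional functions.\<close>
  let ?to = "\<lambda>f. mat p q (\<lambda>(r, c). f c r)"
  let ?from = "\<lambda>M. \<lambda>c\<in>{..<q}. \<lambda>r\<in>{..<p}. M $$ (r, c)"
  have "bij_betw ?to (grids p q) (graph_mosaics p q)"
  proof (rule bij_betw_byWitness[of _ ?from])
    show "\<forall>f\<in>grids p q. ?from (?to f) = f"
    proof
      fix f assume f: "f \<in> grids p q"
      show "?from (?to f) = f"
      proof (intro ext)
        fix c r
        show "?from (?to f) c r = f c r"
          using f unfolding in_grids_iff[OF assms(2)] by (auto simp: extensional_def restrict_def)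
      qed
    qed
    show "\<forall>M\<in>graph_mosaics p q. ?to (?from M) = M"
      by (auto simp: graph_mosaics_def intro!: eq_matI)
    show "?to ` grids p q \<subseteq> graph_mosaics p q"
      using assms
      by (auto simp: in_grids_iff graph_mosaics_def suitably_connected_def no_boundary_points_def)
    show "?from ` graph_mosaics p q \<subseteq> grids p q"
      using assms
      by (auto simp: in_grids_iff graph_mosaics_def suitably_connected_def no_boundary_points_def)
  qed
  then show ?thesis
    using card_grids[of p q] by (simp add: D_G_def bij_betw_same_card)
qed

(* Matrix entries are indexed from 0 by the library, so x_ij is the entry at (i - 1, j - 1). *)
theorem theorem1:
  fixes m n :: nat
  assumes "m > 0" and "n > 0"
  shows "real (D_G (m + 2) (n + 2)) =
    (\<Sum>i = 1..2 ^ (m + n). \<Sum>j = 1..2 ^ (m + n).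
       lucas (b_weight i j) * real_of_int (N_hat m n $$ (i - 1, j - 1)))"
proof -
  have shift: "(\<Sum>i = 1..2 ^ (m + n). F (i - 1)) = (\<Sum>i<2 ^ (m + n). F i)" for F :: "nat \<Rightarrow> real"
    using sum.atLeast_Suc_atMost_Suc_shift[of "\<lambda>i. F (i - 1)" 0 "2 ^ (m + n) - 1"]
    by (simp add: lessThan_Suc_atMost[symmetric] atLeast0AtMost)
  have "real (D_G (m + 2) (n + 2)) = real_of_int (grid (m + 2) (n + 2) 0 0 0 0)"
    by (simp add: D_G_eq_grid[symmetric])
  also have "\<dots> = (\<Sum>L<2 ^ m. \<Sum>T<2 ^ n. \<Sum>R<2 ^ m. \<Sum>B<2 ^ n.
      lucas (hamming_weight (L + 2 ^ m * T) + hamming_weight (R + 2 ^ m * B)) *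
      real_of_int (N_hat m n $$ (L + 2 ^ m * T, R + 2 ^ m * B)))"
    unfolding grid_border
    by (intro sum.cong refl) (simp add: hamming_weight_low_high N_hat_index add.assoc)
  \<comment> \<open>\<open>L\<close> and \<open>T\<close> merge into the row index, \<open>R\<close>
    and \<open>B\<close> into the column index.\<close>
  also have "\<dots> = (\<Sum>i<2 ^ (m + n). \<Sum>j<2 ^ (m + n).
      lucas (hamming_weight i + hamming_weight j) * real_of_int (N_hat m n $$ (i, j)))"
    by (simp only: sum_split_low_high)
  also have "\<dots> = (\<Sum>i<2 ^ (m + n). \<Sum>j = 1..2 ^ (m + n).
      lucas (hamming_weight i + hamming_weight (j - 1)) * real_of_int (N_hat m n $$ (i, j - 1)))"
    by (rule sum.cong[OF refl], rule shift[of "\<lambda>j. lucas (hamming_weight i + hamming_weight j) *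
        real_of_int (N_hat m n $$ (i, j))" for i, symmetric])
  also have "\<dots> = (\<Sum>i = 1..2 ^ (m + n). \<Sum>j = 1..2 ^ (m + n).
      lucas (b_weight i j) * real_of_int (N_hat m n $$ (i - 1, j - 1)))"
    unfolding b_weight_def
    by (rule shift[of "\<lambda>i. \<Sum>j = 1..2 ^ (m + n). lucas (hamming_weight i + hamming_weight (j - 1)) *
        real_of_int (N_hat m n $$ (i, j - 1))", symmetric])
  finally show ?thesis .
qed

end
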